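(* Let $A$ be a triassociative algebra over a field $K$ and let $\Theta_t=\sum_{i=0}^N\theta_it^i$, with $\theta_i=(\lambda_i,\rho_i,\mu_i)$, be a deformation of $A$ of order $N$, where $1\le N<\infty$. Then the element $\mathrm{Ob}_\Theta\in C^3_{\mathrm{Trias}}(A,A)$ is a $3$-cocycle.
   Context: All vector spaces and tensor products are over a fixed field $K$. A triassociative algebra is a vector space $A$ with three bilinear operations $L=\dashv$, $R=\vdash$, $M=\bot$ satisfying, for all $x,y,z$, the following $11$ conditions: (1) $L(L(x,y),z)=L(x,L(y,z))$; (2) $L(L(x,y),z)=L(x,R(y,z))$; (3) $L(R(x,y),z)=R(x,L(y,z))$; (4) $R(L(x,y),z)=R(x,R(y,z))$; (5) $R(R(x,y),z)=R(x,R(y,z))$; (6) $L(L(x,y),z)=L(x,M(y,z))$; (7) $L(M(x,y),z)=M(x,L(y,z))$; (8) $M(L(x,y),z)=M(x,R(y,z))$; (9) $M(R(x,y),z)=R(x,M(y,z))$; (10) $R(M(x,y),z)=R(x,R(y,z))$; (11) $M(M(x,y),z)=M(x,M(y,z))$, where $L(x,y)=x\dashv y$, etc. Trees. $T_n$ ($n\ge0$) is the set of planar rooted trees with $n+1$ leaves in which every internal vertex has at least $2$ incoming edges ($T_0=\{|\}$, no internal vertex); $\psi\in T_n$ has degree $|\psi|=n$; leaves are numbered $0,\dots,n$ from left to right. The grafting $\psi_0\vee\cdots\vee\psi_k$ is obtained by arranging the trees from left to right and joining their roots to a new lowest internal vertex, connected to a new root; every tree of degree $\ge 1$ is uniquely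 of this form with $k\ge1$. A leaf is left (resp. right) oriented if it is the leftmost (resp. rightmost) incoming edge of the vertex it is attached to; otherwise it is a middle leaf. $d_i\colon T_{n+1}\to T_n$ deletes the $i$th leaf (suppressing any vertex left with one incoming edge). For $\psi=\psi_0\vee\cdots\vee\psi_k\in T_{n+1}$ and $0\le i\le n+1$ define $\circ_i^\psi\in\{\dashv,\vdash,\bot\}$ by: $\circ_0^\psi$ is $\dashv$ if $|\psi_0|=0$ and $k=1$; $\vdash$ if $|\psi_0|>0$; $\bot$ if $|\psi_0|=0$ and $k>1$. For $1\le i\le n$, $\circ_i^\psi$ is $\dashv$, $\vdash$, or $\bot$ according as the $i$th leaf is left oriented, right oriented, or a middle leaf. $\circ_{n+1}^\psi$ is $\dashv$ if $|\psi_k|>0$; $\vdash$ if $k=1$ and $|\psi_1|=0$; $\bot$ if $k>1$ and $|\psi_k|=0$. Cohomology. $C^n_{\mathrm{Trias}}(A,A)=\mathrm{Hom}_K(K[T_n]\otimes A^{\otimes n},A)$ for $n\ge 0$, with coboundary $\delta^n=\sum_{i=0}^{n+1}(-1)^i\delta_i^n\colon C^n_{\mathrm{Trias}}(A,A)\to C^{n+1}_{\mathrm{Trias}}(A,A)$, where for $\psi\in T_{n+1}$, $a_1,\dots,a_{n+1}\in A$: $(\delta_0^nf)(\psi;a_1,\dots,a_{n+1})=a_1\circ_0^\psi f(d_0\psi;a_2,\dots,a_{n+1})$; $(\delta_i^nf)(\psi;a_1,\dots,a_{n+1})=f(d_i\psi;a_1,\dots,a_i\circ_i^\psi a_{i+1},\dots,a_{n+1})$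 for $1\le i\le n$; $(\delta_{n+1}^nf)(\psi;a_1,\dots,a_{n+1})=f(d_{n+1}\psi;a_1,\dots,a_n)\circ_{n+1}^\psi a_{n+1}$. A $2$-cochain $\theta\in C^2_{\mathrm{Trias}}(A,A)$ is identified with a triple $(\lambda,\rho,\mu)$ of bilinear operations on $A$ by $\theta(\psi;x,y)=\lambda(x,y)$, $\rho(x,y)$, $\mu(x,y)$ for $\psi=|\vee(|\vee|)$, $(|\vee|)\vee|$, $|\vee|\vee|$ respectively. A deformation of order $N\in\{1,2,\dots\}$ of $A$ is a polynomial $\Theta_t=\sum_{i=0}^N\theta_it^i$ with each $\theta_i=(\lambda_i,\rho_i,\mu_i)\in C^2_{\mathrm{Trias}}(A,A)$ and $\theta_0=(\dashv,\vdash,\bot)$, such that $L_t=\sum\lambda_it^i$, $R_t=\sum\rho_it^i$, $M_t=\sum\mu_it^i$ satisfy conditions (1)-(11) (with $L_t,R_t,M_t$ in place of $L,R,M$, extended linearly) modulo $t^{N+1}$ for all $x,y,z\in A$. Obstruction cochain. Write $Y=|\vee|$, and for bilinear-operation sequences $\alpha,\beta,\gamma,\epsilon\in\{\lambda,\rho,\mu\}$ put $[\alpha\beta;\gamma\epsilon](x,y,z)=\sum_{j=1}^N\big(\alpha_j(\beta_{N+1-j}(x,y),z)-\gamma_j(x,\epsilon_{N+1-j}(y,z))\big)$. Then $\mathrm{Ob}_\Theta\in C^3_{\mathrm{Trias}}(A,A)$ is defined by $\mathrm{Ob}_\Theta(\psi;x,y,z)=$ $[\lambda\lambda;\lambda\lambda]$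 if $\psi=|\vee(|\vee Y)$; $[\lambda\lambda;\lambda\rho]$ if $\psi=|\vee(Y\vee|)$; $[\lambda\rho;\rho\lambda]$ if $\psi=Y\vee Y$; $[\rho\lambda;\rho\rho]$ if $\psi=(|\vee Y)\vee|$; $[\rho\rho;\rho\rho]$ if $\psi=(Y\vee|)\vee|$; $[\lambda\lambda;\lambda\mu]$ if $\psi=|\vee(|\vee|\vee|)$; $[\lambda\mu;\mu\lambda]$ if $\psi=|\vee|\vee Y$; $[\mu\lambda;\mu\rho]$ if $\psi=|\vee Y\vee|$; $[\mu\rho;\rho\mu]$ if $\psi=Y\vee|\vee|$; $[\rho\mu;\rho\rho]$ if $\psi=(|\vee|\vee|)\vee|$; $[\mu\mu;\mu\mu]$ if $\psi=|\vee|\vee|\vee|$ (each evaluated at $(x,y,z)$; these are all $11$ trees of $T_3$). *)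

theory Defs
  imports "HOL-Computational_Algebra.Polynomial"
begin

section \<open>Planar rooted trees\<close>

text \<open>
  \<open>Node [t\<^sub>0, \<dots>, t\<^sub>k]\<close> is the grafting \<open>t\<^sub>0 \<or> \<dots> \<or> t\<^sub>k\<close>, and \<open>Leaf\<close> is the tree \<open>|\<close>
  without internal vertices.  The datatype also contains nodes with fewer than two children;
  these are excluded by \<open>valid_tree\<close>, hence from the sets \<open>T n\<close>.
\<close>

datatype ptree = Leaf | Node "ptree list"

fun valid_tree :: "ptree \<Rightarrow> bool" where
  "valid_tree Leaf \<longleftrightarrow> True"
| "valid_tree (Node ts) \<longleftrightarrow> 2 \<le> length ts \<and> (\<forall>t\<in>set ts. valid_tree t)"

fun leaves :: "ptree \<Rightarrow> nat" where
  "leaves Leaf = 1"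
| "leaves (Node ts) = sum_list (map leaves ts)"

definition tdeg :: "ptree \<Rightarrow> nat" where
  "tdeg t = leaves t - 1"

definition T :: "nat \<Rightarrow> ptree set" where
  "T n = {t. valid_tree t \<and> leaves t = n + 1}"

abbreviation Y :: ptree where
  "Y \<equiv> Node [Leaf, Leaf]"

text \<open>
  Deletion of leaf \<open>i\<close> (leaves are numbered from 0, left to right).  A vertex left with a single
  incoming edge is suppressed by \<open>join_root\<close>.  On \<open>Leaf\<close> the deletion is not meaningful.
\<close>

fun join_root :: "ptree list \<Rightarrow> ptree" where
  "join_root [t] = t"
| "join_root ts = Node ts"

fun del_leaf :: "nat \<Rightarrow> ptree \<Rightarrow> ptree"
  and del_leaf_list :: "nat \<Rightarrow> ptree list \<Rightarrow> ptree list" where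
  "del_leaf i Leaf = Leaf"
| "del_leaf i (Node ts) = join_root (del_leaf_list i ts)"
| "del_leaf_list i [] = []"
| "del_leaf_list i (t # ts) =
    (if i < leaves t then (if t = Leaf then ts else del_leaf i t # ts)
     else t # del_leaf_list (i - leaves t) ts)"

datatype trop = Dashv | Vdash | Perp

text \<open>
  \<open>leaf_op i t\<close> is \<open>Dashv\<close>, \<open>Vdash\<close> or \<open>Perp\<close> according as leaf \<open>i\<close> of \<open>t\<close> is left oriented, right
  oriented or a middle leaf.  In \<open>leaf_op_list b i ts\<close> the list \<open>ts\<close> is a final segment of the
  children of a vertex, and \<open>b\<close> says whether it is the list of all children, i.e. whether its
  first element hangs from the leftmost edge of that vertex.
\<close>

fun leaf_op :: "nat \<Rightarrow> ptree \<Rightarrow> trop"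
  and leaf_op_list :: "bool \<Rightarrow> nat \<Rightarrow> ptree list \<Rightarrow> trop" where
  "leaf_op i Leaf = undefined"
| "leaf_op i (Node ts) = leaf_op_list True i ts"
| "leaf_op_list b i [] = undefined"
| "leaf_op_list b i (t # ts) =
    (if i < leaves t
     then (if t = Leaf then (if b then Dashv else if ts = [] then Vdash else Perp)
           else leaf_op i t)
     else leaf_op_list False (i - leaves t) ts)"

fun circ :: "nat \<Rightarrow> ptree \<Rightarrow> trop" where
  "circ i Leaf = undefined"
| "circ i (Node ts) =
    (let k = length ts - 1 in
     if i = 0 then
       (if tdeg (ts ! 0) > 0 then Vdash else if k = 1 then Dashv else Perp)
     else if i = tdeg (Node ts) then
       (if tdeg (ts ! k) > 0 then Dashv else if k = 1 then Vdash else Perp)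
     else leaf_op i (Node ts))"

section \<open>Triassociative algebras\<close>

definition bilin :: "('k::field \<Rightarrow> 'a::ab_group_add \<Rightarrow> 'a) \<Rightarrow> ('a \<Rightarrow> 'a \<Rightarrow> 'a) \<Rightarrow> bool" where
  "bilin scale f \<longleftrightarrow>
    (\<forall>x. Vector_Spaces.linear scale scale (\<lambda>y. f x y)) \<and>
    (\<forall>y. Vector_Spaces.linear scale scale (\<lambda>x. f x y))"

text \<open>
  The eleven conditions relative to a relation \<open>E\<close>, which is equality for algebras and congruence
  modulo a power of \<open>t\<close> for deformations.
\<close>

definition trias_conds ::
    "('b \<Rightarrow> 'b \<Rightarrow> bool) \<Rightarrow> ('b \<Rightarrow> 'b \<Rightarrow> 'b) \<Rightarrow> ('b \<Rightarrow> 'b \<Rightarrow> 'b) \<Rightarrow> ('b \<Rightarrow> 'b \<Rightarrow> 'b)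
      \<Rightarrow> 'b \<Rightarrow> 'b \<Rightarrow> 'b \<Rightarrow> bool" where
  "trias_conds E L R M x y z \<longleftrightarrow>
     E (L (L x y) z) (L x (L y z)) \<and>
     E (L (L x y) z) (L x (R y z)) \<and>
     E (L (R x y) z) (R x (L y z)) \<and>
     E (R (L x y) z) (R x (R y z)) \<and>
     E (R (R x y) z) (R x (R y z)) \<and>
     E (L (L x y) z) (L x (M y z)) \<and>
     E (L (M x y) z) (M x (L y z)) \<and>
     E (M (L x y) z) (M x (R y z)) \<and>
     E (M (R x y) z) (R x (M y z)) \<and>
     E (R (M x y) z) (R x (R y z)) \<and>
     E (M (M x y) z) (M x (M y z))"

locale trias_algebra = vector_space scale
  for scale :: "'k::field \<Rightarrow> 'a::ab_group_add \<Rightarrow> 'a" +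
  fixes L R M :: "'a \<Rightarrow> 'a \<Rightarrow> 'a"
  assumes bilin_L: "bilin scale L"
    and bilin_R: "bilin scale R"
    and bilin_M: "bilin scale M"
    and conds: "trias_conds (=) L R M x y z"

section \<open>The cochain complex\<close>

text \<open>
  A linear map from \<open>K[T\<^sub>n] \<otimes> A\<^bsup>\<otimes>n\<^esup>\<close> to \<open>A\<close> is a family, indexed by \<open>T n\<close>, of multilinear
  maps in \<open>n\<close> arguments.  Such a family is a function of a tree and an argument list, normalised to
  vanish outside \<open>T n\<close> and lists of length \<open>n\<close>, so that equality of cochains is equality of
  functions.
\<close>

type_synonym 'a cochain = "ptree \<Rightarrow> 'a list \<Rightarrow> 'a"

definition multilin :: "('k::field \<Rightarrow> 'a::ab_group_add \<Rightarrow> 'a) \<Rightarrow> nat \<Rightarrow> ('a list \<Rightarrow> 'a) \<Rightarrow> bool" where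
  "multilin scale n f \<longleftrightarrow>
    (\<forall>as. length as = n \<longrightarrow>
      (\<forall>i<n. Vector_Spaces.linear scale scale (\<lambda>x. f (as[i := x]))))"

definition cochains :: "('k::field \<Rightarrow> 'a::ab_group_add \<Rightarrow> 'a) \<Rightarrow> nat \<Rightarrow> 'a cochain set" where
  "cochains scale n =
    {f. (\<forall>\<psi>\<in>T n. multilin scale n (f \<psi>)) \<and>
        (\<forall>\<psi> as. \<psi> \<notin> T n \<or> length as \<noteq> n \<longrightarrow> f \<psi> as = 0)}"

definition apply_op ::
    "('a \<Rightarrow> 'a \<Rightarrow> 'a) \<Rightarrow> ('a \<Rightarrow> 'a \<Rightarrow> 'a) \<Rightarrow> ('a \<Rightarrow> 'a \<Rightarrow> 'a) \<Rightarrow> trop \<Rightarrow> 'a \<Rightarrow> 'a \<Rightarrow> 'a" where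
  "apply_op L R M c = (case c of Dashv \<Rightarrow> L | Vdash \<Rightarrow> R | Perp \<Rightarrow> M)"

text \<open>
  In \<open>coface\<close> and \<open>coboundary\<close> the argument list is \<open>as = [a\<^sub>1, \<dots>, a\<^sub>n\<^sub>+\<^sub>1]\<close>, so
  \<open>a\<^sub>i\<close> is \<open>as ! (i - 1)\<close>.
\<close>

definition coface ::
    "('a \<Rightarrow> 'a \<Rightarrow> 'a) \<Rightarrow> ('a \<Rightarrow> 'a \<Rightarrow> 'a) \<Rightarrow> ('a \<Rightarrow> 'a \<Rightarrow> 'a)
      \<Rightarrow> nat \<Rightarrow> nat \<Rightarrow> 'a cochain \<Rightarrow> 'a cochain" where
  "coface L R M n i f \<psi> as =
    (let op = apply_op L R M (circ i \<psi>); \<phi> = del_leaf i \<psi> in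
     if i = 0 then op (hd as) (f \<phi> (tl as))
     else if i = n + 1 then op (f \<phi> (butlast as)) (last as)
     else f \<phi> (take (i - 1) as @ [op (as ! (i - 1)) (as ! i)] @ drop (i + 1) as))"

definition coboundary ::
    "('k::field \<Rightarrow> 'a::ab_group_add \<Rightarrow> 'a) \<Rightarrow> ('a \<Rightarrow> 'a \<Rightarrow> 'a) \<Rightarrow> ('a \<Rightarrow> 'a \<Rightarrow> 'a)
      \<Rightarrow> ('a \<Rightarrow> 'a \<Rightarrow> 'a) \<Rightarrow> nat \<Rightarrow> 'a cochain \<Rightarrow> 'a cochain" where
  "coboundary scale L R M n f \<psi> as =
    (if \<psi> \<in> T (n + 1) \<and> length as = n + 1
     then (\<Sum>i=0..n+1. scale ((- 1) ^ i) (coface L R M n i f \<psi> as))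
     else 0)"

definition cocycles ::
    "('k::field \<Rightarrow> 'a::ab_group_add \<Rightarrow> 'a) \<Rightarrow> ('a \<Rightarrow> 'a \<Rightarrow> 'a) \<Rightarrow> ('a \<Rightarrow> 'a \<Rightarrow> 'a)
      \<Rightarrow> ('a \<Rightarrow> 'a \<Rightarrow> 'a) \<Rightarrow> nat \<Rightarrow> 'a cochain set" where
  "cocycles scale L R M n =
    {f \<in> cochains scale n. coboundary scale L R M n f = (\<lambda>\<psi> as. 0)}"

section \<open>Deformations\<close>

text \<open>The triple \<open>(\<lambda>, \<rho>, \<mu>)\<close> of bilinear operations identified with a 2-cochain \<open>\<theta>\<close>.\<close>

definition lam :: "'a cochain \<Rightarrow> 'a \<Rightarrow> 'a \<Rightarrow> 'a" where
  "lam \<theta> x y = \<theta> (Node [Leaf, Y]) [x, y]"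

definition rho :: "'a cochain \<Rightarrow> 'a \<Rightarrow> 'a \<Rightarrow> 'a" where
  "rho \<theta> x y = \<theta> (Node [Y, Leaf]) [x, y]"

definition mu :: "'a cochain \<Rightarrow> 'a \<Rightarrow> 'a \<Rightarrow> 'a" where
  "mu \<theta> x y = \<theta> (Node [Leaf, Leaf, Leaf]) [x, y]"

text \<open>
  \<open>A[t]\<close> is \<open>'a poly\<close>.  \<open>poly_op N \<alpha>\<close> is the \<open>t\<close>-linear extension to \<open>A[t]\<close> of the operation
  \<open>\<alpha>\<^sub>0 + \<alpha>\<^sub>1 t + \<dots> + \<alpha>\<^sub>N t\<^sup>N\<close>.
\<close>

definition poly_op ::
    "nat \<Rightarrow> (nat \<Rightarrow> 'a::ab_group_add \<Rightarrow> 'a \<Rightarrow> 'a) \<Rightarrow> 'a poly \<Rightarrow> 'a poly \<Rightarrow> 'a poly" where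
  "poly_op N \<alpha> p q =
    (\<Sum>i=0..N. \<Sum>r=0..degree p. \<Sum>s=0..degree q.
      monom (\<alpha> i (coeff p r) (coeff q s)) (i + r + s))"

definition cong_t :: "nat \<Rightarrow> 'a::zero poly \<Rightarrow> 'a poly \<Rightarrow> bool" where
  "cong_t m p q \<longleftrightarrow> (\<forall>j<m. coeff p j = coeff q j)"

text \<open>
  A polynomial \<open>\<theta>\<^sub>0 + \<theta>\<^sub>1 t + \<dots> + \<theta>\<^sub>N t\<^sup>N\<close> is given by its coefficient sequence \<open>\<Theta>\<close>, of which
  only the entries up to \<open>N\<close> are ever used.
\<close>

definition deformation ::
    "('k::field \<Rightarrow> 'a::ab_group_add \<Rightarrow> 'a) \<Rightarrow> ('a \<Rightarrow> 'a \<Rightarrow> 'a) \<Rightarrow> ('a \<Rightarrow> 'a \<Rightarrow> 'a)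
      \<Rightarrow> ('a \<Rightarrow> 'a \<Rightarrow> 'a) \<Rightarrow> nat \<Rightarrow> (nat \<Rightarrow> 'a cochain) \<Rightarrow> bool" where
  "deformation scale L R M N \<Theta> \<longleftrightarrow>
    (\<forall>i\<le>N. \<Theta> i \<in> cochains scale 2) \<and>
    lam (\<Theta> 0) = L \<and> rho (\<Theta> 0) = R \<and> mu (\<Theta> 0) = M \<and>
    (\<forall>x y z. trias_conds (cong_t (N + 1))
        (poly_op N (\<lambda>i. lam (\<Theta> i))) (poly_op N (\<lambda>i. rho (\<Theta> i))) (poly_op N (\<lambda>i. mu (\<Theta> i)))
        [:x:] [:y:] [:z:])"

section \<open>The obstruction cochain\<close>

definition obs_bracket ::
    "nat \<Rightarrow> (nat \<Rightarrow> 'a::ab_group_add \<Rightarrow> 'a \<Rightarrow> 'a) \<Rightarrow> (nat \<Rightarrow> 'a \<Rightarrow> 'a \<Rightarrow> 'a)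
      \<Rightarrow> (nat \<Rightarrow> 'a \<Rightarrow> 'a \<Rightarrow> 'a) \<Rightarrow> (nat \<Rightarrow> 'a \<Rightarrow> 'a \<Rightarrow> 'a) \<Rightarrow> 'a \<Rightarrow> 'a \<Rightarrow> 'a \<Rightarrow> 'a" where
  "obs_bracket N \<alpha> \<beta> \<gamma> \<epsilon> x y z =
    (\<Sum>j=1..N. \<alpha> j (\<beta> (N + 1 - j) x y) z - \<gamma> j x (\<epsilon> (N + 1 - j) y z))"

definition Ob :: "nat \<Rightarrow> (nat \<Rightarrow> 'a::ab_group_add cochain) \<Rightarrow> 'a cochain" where
  "Ob N \<Theta> \<psi> as =
    (if length as \<noteq> 3 then 0 else
     let l = (\<lambda>i. lam (\<Theta> i)); r = (\<lambda>i. rho (\<Theta> i)); m = (\<lambda>i. mu (\<Theta> i));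
         ob = (\<lambda>\<alpha> \<beta> \<gamma> \<epsilon>. obs_bracket N \<alpha> \<beta> \<gamma> \<epsilon> (as ! 0) (as ! 1) (as ! 2))
     in
       if \<psi> = Node [Leaf, Node [Leaf, Y]] then ob l l l l
       else if \<psi> = Node [Leaf, Node [Y, Leaf]] then ob l l l r
       else if \<psi> = Node [Y, Y] then ob l r r l
       else if \<psi> = Node [Node [Leaf, Y], Leaf] then ob r l r r
       else if \<psi> = Node [Node [Y, Leaf], Leaf] then ob r r r r
       else if \<psi> = Node [Leaf, Node [Leaf, Leaf, Leaf]] then ob l l l m
       else if \<psi> = Node [Leaf, Leaf, Y] then ob l m m l
       else if \<psi> = Node [Leaf, Y, Leaf] then ob m l m r
       else if \<psi> = Node [Y, Leaf, Leaf] then ob m r r m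
       else if \<psi> = Node [Node [Leaf, Leaf, Leaf], Leaf] then ob r m r r
       else if \<psi> = Node [Leaf, Leaf, Leaf, Leaf] then ob m m m m
       else 0)"

end

theory Submission
  imports Defs
begin

text \<open>
  For each tree in \<open>T 3\<close>, the truncated products \<open>L\<^sub>t, R\<^sub>t, M\<^sub>t\<close> have an associator
  \<open>\<alpha>\<^sub>t(\<beta>\<^sub>t(x, y), z) - \<gamma>\<^sub>t(x, \<epsilon>\<^sub>t(y, z))\<close>.  It vanishes up to \<open>t\<^sup>N\<close>, and its coefficient at
  \<open>t\<^bsup>N+1\<^esup>\<close> is the obstruction cochain.  The coboundary formed with \<open>L\<^sub>t, R\<^sub>t, M\<^sub>t\<close> annihilates these
  associators identically: on each tree in \<open>T 4\<close> it is a sum of ten terms, two for each of the five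
  bracketings of four elements, which cancel in pairs.  As the lower coefficients vanish, the
  coefficient at \<open>t\<^bsup>N+1\<^esup>\<close> of this identity is the cocycle condition over \<open>A\<close>.
\<close>

section \<open>Enumeration of trees\<close>

text \<open>Unlike the children of a vertex, such a list may be empty or a singleton, so it can be
  enumerated by splitting off one tree at a time.\<close>

definition forests :: "nat \<Rightarrow> ptree list set" where
  "forests n = {ts. (\<forall>t\<in>set ts. valid_tree t) \<and> sum_list (map leaves ts) = n}"

lemma valid_tree_leaves_pos: "valid_tree t \<Longrightarrow> 0 < leaves t"
proof (induction t rule: valid_tree.induct)
  case (2 ts)
  then obtain t us where "ts = t # us" by (cases ts) auto
  with 2 show ?case by auto
qed simp

lemma forests_0: "forests 0 = {[]}"
proof -
  have "ts = []" if "ts \<in> forests 0" for ts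
    using that by (cases ts) (auto simp: forests_def dest: valid_tree_leaves_pos)
  then show ?thesis by (auto simp: forests_def)
qed

lemma forests_Suc: "forests (Suc n) = (\<Union>k\<le>n. \<Union>t\<in>T k. (#) t ` forests (n - k))"
proof (intro set_eqI iffI)
  fix ts assume ts: "ts \<in> forests (Suc n)"
  then obtain t us where tu: "ts = t # us" by (cases ts) (auto simp: forests_def)
  have v: "valid_tree t" using ts tu by (auto simp: forests_def)
  then have p: "0 < leaves t" by (rule valid_tree_leaves_pos)
  have "leaves t - 1 \<le> n" "t \<in> T (leaves t - 1)" "us \<in> forests (n - (leaves t - 1))"
    using ts tu v p by (auto simp: forests_def T_def)
  then show "ts \<in> (\<Union>k\<le>n. \<Union>t\<in>T k. (#) t ` forests (n - k))" using tu by blast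
qed (auto simp: forests_def T_def)

lemma T_0: "T 0 = {Leaf}"
proof -
  have "t = Leaf" if "t \<in> T 0" for t
  proof (cases t)
    case (Node ts)
    then have "2 \<le> length ts" using that by (auto simp: T_def)
    then obtain t1 t2 us where ts: "ts = t1 # t2 # us"
      by (cases ts; cases "tl ts") auto
    then have "valid_tree t1" "valid_tree t2" "leaves t1 + leaves t2 \<le> 1"
      using that Node by (auto simp: T_def)
    then show ?thesis
      using valid_tree_leaves_pos[of t1] valid_tree_leaves_pos[of t2] by linarith
  qed
  then show ?thesis by (auto simp: T_def)
qed

text \<open>A first child of degree \<open>k\<close> uses \<open>k + 1\<close> of the
  \<open>n + 2\<close> leaves. The bound \<open>k \<le> n\<close> leaves at least one leaf for the
  others, so the root has a second child.\<close>

lemma T_Suc: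
  "T (Suc n) = (\<Union>k\<le>n. \<Union>t\<in>T k. (\<lambda>ts. Node (t # ts)) ` forests (Suc n - k))"
proof (intro set_eqI iffI)
  fix \<psi> assume psi: "\<psi> \<in> T (Suc n)"
  then obtain ts where ts: "\<psi> = Node ts" by (cases \<psi>) (auto simp: T_def)
  then have "2 \<le> length ts" using psi by (auto simp: T_def)
  then obtain t s us where tu: "ts = t # s # us"
    by (cases ts; cases "tl ts") auto
  have v: "valid_tree t" "valid_tree s" using psi ts tu by (auto simp: T_def)
  note p = v[THEN valid_tree_leaves_pos]
  have "leaves t - 1 \<le> n" "t \<in> T (leaves t - 1)" "s # us \<in> forests (Suc n - (leaves t - 1))"
    using psi ts tu v p by (auto simp: forests_def T_def)
  then show "\<psi> \<in> (\<Union>k\<le>n. \<Union>t\<in>T k. (\<lambda>ts. Node (t # ts)) ` forests (Suc n - k))"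
    using ts tu by blast
next
  fix \<psi> assume "\<psi> \<in> (\<Union>k\<le>n. \<Union>t\<in>T k. (\<lambda>ts. Node (t # ts)) ` forests (Suc n - k))"
  then obtain k t ts where *: "k \<le> n" "t \<in> T k" "ts \<in> forests (Suc n - k)" "\<psi> = Node (t # ts)"
    by blast
  then have "ts \<noteq> []" by (auto simp: forests_def)
  then have "1 \<le> length ts" by (cases ts) auto
  with * show "\<psi> \<in> T (Suc n)" by (auto simp: forests_def T_def)
qed

lemma T_1: "T (Suc 0) = {Y}"
  by (simp add: T_Suc T_0 forests_Suc forests_0)

lemma T_2: "T (Suc (Suc 0)) = {Node [Leaf, Y], Node [Y, Leaf], Node [Leaf, Leaf, Leaf]}"
  by (auto simp add: T_Suc[of "Suc 0"] T_0 T_1 forests_Suc forests_0 atMost_Suc)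

lemma T_3: "T 3 =
  {Node [Leaf, Node [Leaf, Y]], Node [Leaf, Node [Y, Leaf]], Node [Y, Y],
   Node [Node [Leaf, Y], Leaf], Node [Node [Y, Leaf], Leaf],
   Node [Leaf, Node [Leaf, Leaf, Leaf]], Node [Leaf, Leaf, Y], Node [Leaf, Y, Leaf],
   Node [Y, Leaf, Leaf], Node [Node [Leaf, Leaf, Leaf], Leaf], Node [Leaf, Leaf, Leaf, Leaf]}"
  by (auto simp add: numeral_3_eq_3 T_Suc[of "Suc (Suc 0)"] T_0 T_1 T_2
      forests_Suc forests_0 atMost_Suc)

text \<open>
  The identities are the compatibilities that make the five bracketings in the pentagon cancel
  (see \<open>tree_assoc\<close> for the operations attached to a tree in \<open>T 3\<close>).
\<close>

lemma circ_T_4: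
  "\<forall>\<psi>\<in>T 4. (\<forall>i\<in>{0, 1, 2, 3, 4}. del_leaf i \<psi> \<in> T 3) \<and>
    circ 1 (del_leaf 1 (del_leaf 1 \<psi>)) = circ 4 \<psi> \<and>
    circ 1 (del_leaf 1 (del_leaf 2 \<psi>)) = circ 4 \<psi> \<and>
    circ 1 (del_leaf 2 (del_leaf 2 \<psi>)) = circ 0 \<psi> \<and>
    circ 1 (del_leaf 2 (del_leaf 3 \<psi>)) = circ 0 \<psi> \<and>
    circ 1 (del_leaf 4 \<psi>) = circ 1 \<psi> \<and>
    circ 1 (del_leaf 3 \<psi>) = circ 1 \<psi> \<and>
    circ 2 (del_leaf 4 \<psi>) = circ 2 \<psi> \<and>
    circ 1 (del_leaf 0 \<psi>) = circ 2 \<psi> \<and>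
    circ 2 (del_leaf 1 \<psi>) = circ 3 \<psi> \<and>
    circ 2 (del_leaf 0 \<psi>) = circ 3 \<psi> \<and>
    circ 1 (del_leaf 1 \<psi>) = circ 1 (del_leaf 1 (del_leaf 4 \<psi>)) \<and>
    circ 1 (del_leaf 2 \<psi>) = circ 1 (del_leaf 2 (del_leaf 4 \<psi>)) \<and>
    circ 2 (del_leaf 2 \<psi>) = circ 1 (del_leaf 1 (del_leaf 0 \<psi>)) \<and>
    circ 2 (del_leaf 3 \<psi>) = circ 1 (del_leaf 2 (del_leaf 0 \<psi>)) \<and>
    circ 1 (del_leaf 2 (del_leaf 1 \<psi>)) = circ 1 (del_leaf 1 (del_leaf 3 \<psi>))"
proof -
  have T_4: "T 4 = (\<Union>k\<le>3. \<Union>t\<in>T k. (\<lambda>ts. Node (t # ts)) ` forests (4 - k))"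
    using T_Suc[of 3] by simp
  have T_2': "T 2 = T (Suc (Suc 0))" by (simp only: numeral_2_eq_2)
  have k: "{..3::nat} = {0, Suc 0, 2, 3}" by auto
  have f: "forests 2 = forests (Suc (Suc 0))" "forests 3 = forests (Suc (Suc (Suc 0)))"
      "forests 4 = forests (Suc (Suc (Suc (Suc 0))))"
    by (simp_all add: numeral_eq_Suc)
  \<comment> \<open>Finite check: \<open>T 4\<close> unfolds to its 45 trees, and every identity is
    evaluated on each.\<close>
  show ?thesis
    unfolding T_4 k
    by (simp add: T_0 T_1 T_2' T_2 T_3 T_3[unfolded numeral_3_eq_3] f forests_Suc forests_0
        atMost_Suc tdeg_def)
qed

section \<open>Convolutions\<close>

text \<open>Summing over the symmetric index set turns permutations of the indices into bijections,
  from which the two reorderings below follow.\<close>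

lemma triple_conv_eq:
  fixes f :: "nat \<Rightarrow> nat \<Rightarrow> nat \<Rightarrow> 'a::comm_monoid_add"
  shows "(\<Sum>i\<le>m. \<Sum>j\<le>m - i. f i j (m - i - j)) = (\<Sum>(i, j, k)\<in>{(i, j, k). i + j + k = m}. f i j k)"
proof -
  have "(\<Sum>i\<le>m. \<Sum>j\<le>m - i. f i j (m - i - j))
      = (\<Sum>(i, j)\<in>(SIGMA i:{..m}. {..m - i}). f i j (m - i - j))"
    by (rule sum.Sigma) auto
  also have "\<dots> = (\<Sum>(i, j, k)\<in>{(i, j, k). i + j + k = m}. f i j k)"
    by (rule sum.reindex_bij_witness[where i = "\<lambda>(i, j, k). (i, j)" and j = "\<lambda>(i, j). (i, j, m - i - j)"])
      auto
  finally show ?thesis .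
qed

lemma triple_conv_rotate:
  fixes f :: "nat \<Rightarrow> nat \<Rightarrow> nat \<Rightarrow> 'a::comm_monoid_add"
  shows "(\<Sum>k\<le>m. \<Sum>i\<le>m - k. f i (m - k - i) k) = (\<Sum>i\<le>m. \<Sum>j\<le>m - i. f i j (m - i - j))"
  unfolding triple_conv_eq triple_conv_eq[of "\<lambda>k i j. f i j k"]
  by (rule sum.reindex_bij_witness[where i = "\<lambda>(i, j, k). (k, i, j)" and j = "\<lambda>(k, i, j). (i, j, k)"])
    auto

lemma triple_conv_reverse:
  fixes f :: "nat \<Rightarrow> nat \<Rightarrow> nat \<Rightarrow> 'a::comm_monoid_add"
  shows "(\<Sum>k\<le>m. \<Sum>i\<le>m - k. f (m - k - i) i k) = (\<Sum>i\<le>m. \<Sum>j\<le>m - i. f i j (m - i - j))"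
  unfolding triple_conv_eq triple_conv_eq[of "\<lambda>k i j. f j i k"]
  by (rule sum.reindex_bij_witness[where i = "\<lambda>(i, j, k). (k, j, i)" and j = "\<lambda>(k, i, j). (j, i, k)"])
    auto

text \<open>The coefficient of t^n in the associator of four formal power series of
  operations.\<close>

definition assoc_coeff ::
    "(nat \<Rightarrow> 'a::ab_group_add \<Rightarrow> 'a \<Rightarrow> 'a) \<Rightarrow> (nat \<Rightarrow> 'a \<Rightarrow> 'a \<Rightarrow> 'a) \<Rightarrow> (nat \<Rightarrow> 'a \<Rightarrow> 'a \<Rightarrow> 'a)
      \<Rightarrow> (nat \<Rightarrow> 'a \<Rightarrow> 'a \<Rightarrow> 'a) \<Rightarrow> nat \<Rightarrow> 'a \<Rightarrow> 'a \<Rightarrow> 'a \<Rightarrow> 'a" where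
  "assoc_coeff \<alpha> \<beta> \<gamma> \<epsilon> n x y z = (\<Sum>i\<le>n. \<alpha> i (\<beta> (n - i) x y) z - \<gamma> i x (\<epsilon> (n - i) y z))"

text \<open>What is needed to move an operation through the sums and differences in
  \<open>assoc_coeff\<close>.\<close>

definition biadditive :: "('a::ab_group_add \<Rightarrow> 'a \<Rightarrow> 'a) \<Rightarrow> bool" where
  "biadditive f \<longleftrightarrow> (\<forall>x. additive (f x)) \<and> (\<forall>y. additive (\<lambda>x. f x y))"

lemma biadditive_left:
  assumes "biadditive f"
  shows "f 0 z = 0" "f (x - y) z = f x z - f y z" "f (\<Sum>i\<in>I. g i) z = (\<Sum>i\<in>I. f (g i) z)"
proof -
  have a: "additive (\<lambda>x. f x z)" using assms by (simp add: biadditive_def)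
  show "f 0 z = 0" "f (x - y) z = f x z - f y z" "f (\<Sum>i\<in>I. g i) z = (\<Sum>i\<in>I. f (g i) z)"
    using additive.zero[OF a] additive.diff[OF a] additive.sum[OF a] by auto
qed

lemma biadditive_right:
  assumes "biadditive f"
  shows "f z 0 = 0" "f z (x - y) = f z x - f z y" "f z (\<Sum>i\<in>I. g i) = (\<Sum>i\<in>I. f z (g i))"
proof -
  have a: "additive (f z)" using assms by (simp add: biadditive_def)
  show "f z 0 = 0" "f z (x - y) = f z x - f z y" "f z (\<Sum>i\<in>I. g i) = (\<Sum>i\<in>I. f z (g i))"
    using additive.zero[OF a] additive.diff[OF a] additive.sum[OF a] by auto
qed

text \<open>Each of the five bracketings of x, y, z, w arises from two of the associators, with
  opposite signs. \<open>o0\<close> and \<open>o4\<close> are applied to whole associators, so they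
  must distribute over them.\<close>

lemma pentagon_identity:
  assumes o0: "\<And>i. biadditive (o0 i)" and o4: "\<And>i. biadditive (o4 i)"
  shows "(\<Sum>k\<le>m. o0 k x (assoc_coeff s o2 u o3 (m - k) y z w))
    - (\<Sum>k\<le>m. assoc_coeff o4 p r o3 (m - k) (o1 k x y) z w)
    + (\<Sum>k\<le>m. assoc_coeff o4 q o0 s (m - k) x (o2 k y z) w)
    - (\<Sum>k\<le>m. assoc_coeff r o1 o0 u (m - k) x y (o3 k z w))
    + (\<Sum>k\<le>m. o4 k (assoc_coeff p o1 q o2 (m - k) x y z) w) = 0"
  \<comment> \<open>The two copies of a bracketing sum over the degrees in different orders. A
    cyclic shift aligns them, except for (xy)(zw), whose indices come reversed.\<close>
  using triple_conv_rotate[where m = m and f = "\<lambda>a b c. o4 a (p b (o1 c x y) z) w"]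
    triple_conv_reverse[where m = m and f = "\<lambda>c a b. r a (o1 b x y) (o3 c z w)"]
    triple_conv_rotate[where m = m and f = "\<lambda>a b c. o4 a (q b x (o2 c y z)) w"]
    triple_conv_rotate[where m = m and f = "\<lambda>a b c. o0 a x (s b (o2 c y z) w)"]
    triple_conv_rotate[where m = m and f = "\<lambda>a b c. o0 a x (u b y (o3 c z w))"]
    triple_conv_reverse[where m = m and f = "\<lambda>a b c. r b (o1 a x y) (o3 c z w)"]
  by (simp add: assoc_coeff_def sum_subtractf biadditive_left[OF o4] biadditive_right[OF o0])


text \<open>
  The operations are read off from the tree: for \<open>\<phi>\<close> in \<open>T 2\<close>, \<open>circ 1 \<phi>\<close> is the operation by which
  a 2-cochain is evaluated on \<open>\<phi>\<close>.
\<close>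

definition tree_assoc ::
    "(trop \<Rightarrow> nat \<Rightarrow> 'a::ab_group_add \<Rightarrow> 'a \<Rightarrow> 'a) \<Rightarrow> ptree \<Rightarrow> nat \<Rightarrow> 'a \<Rightarrow> 'a \<Rightarrow> 'a \<Rightarrow> 'a" where
  "tree_assoc P \<psi> = assoc_coeff (P (circ 1 (del_leaf 1 \<psi>))) (P (circ 1 \<psi>))
    (P (circ 1 (del_leaf 2 \<psi>))) (P (circ 2 \<psi>))"

lemma sum_atMost_lower_zero:
  fixes f :: "nat \<Rightarrow> 'a::comm_monoid_add"
  assumes "\<And>k. 0 < k \<Longrightarrow> k \<le> m \<Longrightarrow> f k = 0"
  shows "(\<Sum>k\<le>m. f k) = f 0"
  using assms by (subst sum.atMost_shift) simp

text \<open>By \<open>circ_T_4\<close> the associators on the five faces of \<psi> have the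
  operations of the pentagon identity, whose coefficient at t^m is taken.\<close>

lemma tree_assoc_cocycle:
  assumes P: "\<And>c i. biadditive (P c i)"
    and low: "\<And>\<psi> n x y z. \<psi> \<in> T 3 \<Longrightarrow> n < m \<Longrightarrow> tree_assoc P \<psi> n x y z = 0"
    and psi: "\<psi> \<in> T 4"
  shows "P (circ 0 \<psi>) 0 x (tree_assoc P (del_leaf 0 \<psi>) m y z w)
    - tree_assoc P (del_leaf 1 \<psi>) m (P (circ 1 \<psi>) 0 x y) z w
    + tree_assoc P (del_leaf 2 \<psi>) m x (P (circ 2 \<psi>) 0 y z) w
    - tree_assoc P (del_leaf 3 \<psi>) m x y (P (circ 3 \<psi>) 0 z w)
    + P (circ 4 \<psi>) 0 (tree_assoc P (del_leaf 4 \<psi>) m x y z) w = 0"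
proof -
  note c = circ_T_4[rule_format, OF psi]
  have d: "del_leaf 0 \<psi> \<in> T 3" "del_leaf 1 \<psi> \<in> T 3" "del_leaf 2 \<psi> \<in> T 3"
    "del_leaf 3 \<psi> \<in> T 3" "del_leaf 4 \<psi> \<in> T 3"
    using c by auto
  \<comment> \<open>Besides the \<open>circ i \<psi>\<close>, five operations occur in the
    bracketings: \<open>p\<close> joins xy with z, \<open>q\<close> x with yz, \<open>r\<close> xy
    with zw, \<open>s\<close> yz with w, \<open>u\<close> y with zw. Each is shared by two faces and
    is read off here from one of them.\<close>
  define p where "p = P (circ 1 (del_leaf 1 (del_leaf 4 \<psi>)))"
  define q where "q = P (circ 1 (del_leaf 2 (del_leaf 4 \<psi>)))"
  define r where "r = P (circ 1 (del_leaf 2 (del_leaf 1 \<psi>)))"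
  define s where "s = P (circ 1 (del_leaf 1 (del_leaf 0 \<psi>)))"
  define u where "u = P (circ 1 (del_leaf 2 (del_leaf 0 \<psi>)))"
  let ?o = "\<lambda>i. P (circ i \<psi>)"
  have a: "tree_assoc P (del_leaf 0 \<psi>) = assoc_coeff s (?o 2) u (?o 3)"
    "tree_assoc P (del_leaf 1 \<psi>) = assoc_coeff (?o 4) p r (?o 3)"
    "tree_assoc P (del_leaf 2 \<psi>) = assoc_coeff (?o 4) q (?o 0) s"
    "tree_assoc P (del_leaf 3 \<psi>) = assoc_coeff r (?o 1) (?o 0) u"
    "tree_assoc P (del_leaf 4 \<psi>) = assoc_coeff p (?o 1) q (?o 2)"
    using c by (simp_all add: tree_assoc_def p_def q_def r_def s_def u_def)
  note pent = pentagon_identity[where m = m and x = x and y = y and z = z and w = w and ?o0.0 = "?o 0"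
      and ?o1.0 = "?o 1" and ?o2.0 = "?o 2" and ?o3.0 = "?o 3" and ?o4.0 = "?o 4"
      and p = p and q = q and r = r and s = s and u = u,
      OF P P, folded a]
  \<comment> \<open>For \<open>k > 0\<close> the associator has degree \<open>m - k < m\<close> and
    vanishes by \<open>low\<close>, so each sum reduces to its term at \<open>k = 0\<close>.\<close>
  have "(\<Sum>k\<le>m. ?o 0 k x (tree_assoc P (del_leaf 0 \<psi>) (m - k) y z w))
      = ?o 0 0 x (tree_assoc P (del_leaf 0 \<psi>) (m - 0) y z w)"
    by (rule sum_atMost_lower_zero) (simp add: low d biadditive_right[OF P])
  moreover have "(\<Sum>k\<le>m. tree_assoc P (del_leaf 1 \<psi>) (m - k) (?o 1 k x y) z w)
      = tree_assoc P (del_leaf 1 \<psi>) (m - 0) (?o 1 0 x y) z w"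
    by (rule sum_atMost_lower_zero) (simp add: low d[simplified])
  moreover have "(\<Sum>k\<le>m. tree_assoc P (del_leaf 2 \<psi>) (m - k) x (?o 2 k y z) w)
      = tree_assoc P (del_leaf 2 \<psi>) (m - 0) x (?o 2 0 y z) w"
    by (rule sum_atMost_lower_zero) (simp add: low d)
  moreover have "(\<Sum>k\<le>m. tree_assoc P (del_leaf 3 \<psi>) (m - k) x y (?o 3 k z w))
      = tree_assoc P (del_leaf 3 \<psi>) (m - 0) x y (?o 3 0 z w)"
    by (rule sum_atMost_lower_zero) (simp add: low d)
  moreover have "(\<Sum>k\<le>m. ?o 4 k (tree_assoc P (del_leaf 4 \<psi>) (m - k) x y z) w)
      = ?o 4 0 (tree_assoc P (del_leaf 4 \<psi>) (m - 0) x y z) w"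
    by (rule sum_atMost_lower_zero) (simp add: low d biadditive_left[OF P])
  ultimately show ?thesis using pent by simp
qed

section \<open>Bilinear operations\<close>

lemma bilin_biadditive: "bilin scale f \<Longrightarrow> biadditive f"
  by (simp add: bilin_def biadditive_def additive_def Vector_Spaces.linear_iff)

lemma bilin_zero: "vector_space scale \<Longrightarrow> bilin scale (\<lambda>x y. 0)"
  by (simp add: bilin_def Vector_Spaces.linear_iff module.scale_zero_right module_iff_vector_space)

lemma bilin_of_cochain:
  assumes "\<theta> \<in> cochains scale 2" and "\<psi> \<in> T 2"
  shows "bilin scale (\<lambda>x y. \<theta> \<psi> [x, y])"
  unfolding bilin_def
proof (intro conjI allI)
  have lin: "Vector_Spaces.linear scale scale (\<lambda>v. \<theta> \<psi> (as[i := v]))"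
    if "length as = 2" "i < 2" for as i
    using assms that by (auto simp: cochains_def multilin_def)
  show "Vector_Spaces.linear scale scale (\<lambda>y. \<theta> \<psi> [x, y])" for x
    \<comment> \<open>The entry at the updated position is a dummy, so a repeated argument fills
      it.\<close>
    using lin[of "[x, x]" 1] by simp
  show "Vector_Spaces.linear scale scale (\<lambda>x. \<theta> \<psi> [x, y])" for y
    using lin[of "[y, y]" 0] by simp
qed

lemma linear_assoc_coeff:
  assumes v: "vector_space scale"
    and b: "\<And>i. bilin scale (\<alpha> i)" "\<And>i. bilin scale (\<beta> i)"
      "\<And>i. bilin scale (\<gamma> i)" "\<And>i. bilin scale (\<epsilon> i)"
  shows "Vector_Spaces.linear scale scale (\<lambda>x. assoc_coeff \<alpha> \<beta> \<gamma> \<epsilon> n x y z)"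
    and "Vector_Spaces.linear scale scale (\<lambda>y. assoc_coeff \<alpha> \<beta> \<gamma> \<epsilon> n x y z)"
    and "Vector_Spaces.linear scale scale (\<lambda>z. assoc_coeff \<alpha> \<beta> \<gamma> \<epsilon> n x y z)"
  using b v unfolding bilin_def Vector_Spaces.linear_iff assoc_coeff_def
  by (simp_all add: sum.distrib sum_subtractf algebra_simps module.scale_sum_right
      module.scale_right_diff_distrib module_iff_vector_space)

section \<open>Coefficients of a deformation\<close>

lemma coeff_poly_op_const:
  "coeff (poly_op N \<alpha> [:x:] [:y:]) n = (if n \<le> N then \<alpha> n x y else 0)"
  by (simp add: poly_op_def coeff_sum coeff_monom atLeast0AtMost)

text \<open>The sum picks out \<open>r = n - i\<close>. If this exceeds the degree, the coefficient
  is 0 and \<open>g 0 = 0\<close> gives the right value.\<close>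

lemma sum_monom_degree:
  assumes "g 0 = 0"
  shows "(\<Sum>r\<le>degree p. if i + r = n then g (coeff p r) else 0)
    = (if i \<le> n then g (coeff p (n - i)) else 0)"
proof (cases "i \<le> n")
  case True
  then have "(\<Sum>r\<le>degree p. if i + r = n then g (coeff p r) else 0)
      = (\<Sum>r\<le>degree p. if r = n - i then g (coeff p r) else 0)"
    by (intro sum.cong) auto
  then show ?thesis using True assms by (simp add: coeff_eq_0)
qed simp

text \<open>For \<open>n \<le> N\<close> the truncation at \<open>N\<close> cuts off no term of the
  Cauchy product.\<close>

lemma coeff_poly_op_left:
  assumes "n \<le> N" and "\<And>i. i \<le> N \<Longrightarrow> \<alpha> i 0 z = 0"
  shows "coeff (poly_op N \<alpha> p [:z:]) n = (\<Sum>i\<le>n. \<alpha> i (coeff p (n - i)) z)"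
proof -
  have "coeff (poly_op N \<alpha> p [:z:]) n
      = (\<Sum>i\<le>N. if i \<le> n then \<alpha> i (coeff p (n - i)) z else 0)"
    by (auto simp: poly_op_def coeff_sum coeff_monom atLeast0AtMost
        sum_monom_degree[where g = "\<lambda>c. \<alpha> i c z" for i] assms(2) intro!: sum.cong)
  also have "\<dots> = (\<Sum>i\<le>n. \<alpha> i (coeff p (n - i)) z)"
    using assms(1) by (intro sum.mono_neutral_cong_right) auto
  finally show ?thesis .
qed

lemma coeff_poly_op_right:
  assumes "n \<le> N" and "\<And>i. i \<le> N \<Longrightarrow> \<alpha> i x 0 = 0"
  shows "coeff (poly_op N \<alpha> [:x:] p) n = (\<Sum>i\<le>n. \<alpha> i x (coeff p (n - i)))"
proof -
  have "coeff (poly_op N \<alpha> [:x:] p) n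
      = (\<Sum>i\<le>N. if i \<le> n then \<alpha> i x (coeff p (n - i)) else 0)"
    by (auto simp: poly_op_def coeff_sum coeff_monom atLeast0AtMost
        sum_monom_degree[where g = "\<lambda>c. \<alpha> i x c" for i] assms(2) intro!: sum.cong)
  also have "\<dots> = (\<Sum>i\<le>n. \<alpha> i x (coeff p (n - i)))"
    using assms(1) by (intro sum.mono_neutral_cong_right) auto
  finally show ?thesis .
qed

text \<open>
  Setting \<open>\<theta>\<^sub>i = 0\<close> for \<open>i > N\<close> removes the terms \<open>j = 0\<close> and \<open>j = N + 1\<close> from the coefficient at
  \<open>t\<^bsup>N+1\<^esup>\<close>, which leaves exactly the range of summation of \<open>obs_bracket\<close>.
\<close>

definition trunc_op :: "nat \<Rightarrow> (nat \<Rightarrow> 'a::ab_group_add cochain) \<Rightarrow> trop \<Rightarrow> nat \<Rightarrow> 'a \<Rightarrow> 'a \<Rightarrow> 'a" where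
  "trunc_op N \<Theta> c i =
    (if i \<le> N then apply_op (lam (\<Theta> i)) (rho (\<Theta> i)) (mu (\<Theta> i)) c else (\<lambda>x y. 0))"

lemma trunc_op_simps:
  assumes "i \<le> N"
  shows "trunc_op N \<Theta> Dashv i = lam (\<Theta> i)" "trunc_op N \<Theta> Vdash i = rho (\<Theta> i)"
    "trunc_op N \<Theta> Perp i = mu (\<Theta> i)"
  using assms by (simp_all add: trunc_op_def apply_op_def)

lemma bilin_trunc_op:
  assumes "vector_space scale" and "\<And>i. i \<le> N \<Longrightarrow> \<Theta> i \<in> cochains scale 2"
  shows "bilin scale (trunc_op N \<Theta> c i)"
proof (cases "i \<le> N")
  case True
  have "bilin scale (lam (\<Theta> i))" "bilin scale (rho (\<Theta> i))" "bilin scale (mu (\<Theta> i))"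
    using bilin_of_cochain[OF assms(2)[OF True]]
    by (simp_all add: lam_def[abs_def] rho_def[abs_def] mu_def[abs_def] T_2 numeral_2_eq_2)
  then show ?thesis using True by (cases c) (simp_all add: trunc_op_def apply_op_def)
next
  case False
  then show ?thesis using bilin_zero[OF assms(1)] by (simp add: trunc_op_def)
qed

lemma cong_t_poly_op_iff:
  assumes "\<And>i x. i \<le> N \<Longrightarrow> \<alpha> i 0 x = 0" and "\<And>i x. i \<le> N \<Longrightarrow> \<gamma> i x 0 = 0"
  shows "cong_t (Suc N) (poly_op N \<alpha> (poly_op N \<beta> [:x:] [:y:]) [:z:])
      (poly_op N \<gamma> [:x:] (poly_op N \<epsilon> [:y:] [:z:]))
    \<longleftrightarrow> (\<forall>n\<le>N. assoc_coeff \<alpha> \<beta> \<gamma> \<epsilon> n x y z = 0)"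
proof -
  have "coeff (poly_op N \<alpha> (poly_op N \<beta> [:x:] [:y:]) [:z:]) n
        = (\<Sum>i\<le>n. \<alpha> i (\<beta> (n - i) x y) z)"
      "coeff (poly_op N \<gamma> [:x:] (poly_op N \<epsilon> [:y:] [:z:])) n
        = (\<Sum>i\<le>n. \<gamma> i x (\<epsilon> (n - i) y z))" if "n \<le> N" for n
    using that
    by (auto simp: coeff_poly_op_left coeff_poly_op_right coeff_poly_op_const assms intro!: sum.cong)
  then show ?thesis
    by (auto simp: cong_t_def assoc_coeff_def sum_subtractf less_Suc_eq_le)
qed

lemma poly_op_cong: "(\<And>i. i \<le> N \<Longrightarrow> \<alpha> i = \<beta> i) \<Longrightarrow> poly_op N \<alpha> = poly_op N \<beta>"
  by (simp add: poly_op_def fun_eq_iff)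

lemma deformation_tree_assoc:
  assumes v: "vector_space scale" and def: "deformation scale L R M N \<Theta>"
    and psi: "\<psi> \<in> T 3" and n: "n \<le> N"
  shows "tree_assoc (trunc_op N \<Theta>) \<psi> n x y z = 0"
proof -
  let ?P = "trunc_op N \<Theta>"
  have b: "biadditive (?P c i)" for c i
    using def bilin_trunc_op[OF v] by (intro bilin_biadditive[where scale = scale]) (simp add: deformation_def)
  \<comment> \<open>\<open>poly_op N\<close> reads only indices up to \<open>N\<close>, where
    truncation changes nothing.\<close>
  have "poly_op N (\<lambda>i. lam (\<Theta> i)) = poly_op N (?P Dashv)"
    "poly_op N (\<lambda>i. rho (\<Theta> i)) = poly_op N (?P Vdash)"
    "poly_op N (\<lambda>i. mu (\<Theta> i)) = poly_op N (?P Perp)"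
    by (rule poly_op_cong, simp add: trunc_op_simps)+
  then have "trias_conds (cong_t (N + 1)) (poly_op N (?P Dashv)) (poly_op N (?P Vdash))
      (poly_op N (?P Perp)) [:x:] [:y:] [:z:]"
    using def by (simp add: deformation_def)
  \<comment> \<open>On each of the eleven trees \<open>tree_assoc\<close> reads off the operations
    of one of the eleven conditions.\<close>
  then have "\<forall>n\<le>N. tree_assoc ?P \<psi> n x y z = 0"
    using psi unfolding trias_conds_def
    by (auto simp add: cong_t_poly_op_iff biadditive_left[OF b] biadditive_right[OF b] T_3 tree_assoc_def
        tdeg_def)
  with n show ?thesis by blast
qed

section \<open>The obstruction cochain and its cocycle condition\<close>

lemma Ob_eq_tree_assoc:
  assumes "\<psi> \<in> T 3" and b: "\<And>c i. biadditive (trunc_op N \<Theta> c i)"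
  shows "Ob N \<Theta> \<psi> [x, y, z] = tree_assoc (trunc_op N \<Theta>) \<psi> (N + 1) x y z"
proof -
  let ?P = "trunc_op N \<Theta>"
  have "assoc_coeff (?P a) (?P b) (?P c) (?P e) (N + 1) x y z
      = obs_bracket N (?P a) (?P b) (?P c) (?P e) x y z" for a b c e
  proof -
    have zero: "?P c (Suc N) = (\<lambda>x y. 0)" for c by (simp add: trunc_op_def)
    have "{..N + 1} = insert 0 (insert (N + 1) {1..N})" by auto
    then show ?thesis
      by (simp add: assoc_coeff_def obs_bracket_def zero biadditive_left[OF b]
          biadditive_right[OF b])
  qed
  \<comment> \<open>For \<open>j\<close> from 1 to \<open>N\<close> both \<open>j\<close> and
    \<open>N + 1 - j\<close> lie in this range, where truncation changes nothing.\<close>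
  moreover have "obs_bracket N (?P a) (?P b) (?P c) (?P e) x y z
      = obs_bracket N (\<lambda>i. apply_op (lam (\<Theta> i)) (rho (\<Theta> i)) (mu (\<Theta> i)) a)
        (\<lambda>i. apply_op (lam (\<Theta> i)) (rho (\<Theta> i)) (mu (\<Theta> i)) b)
        (\<lambda>i. apply_op (lam (\<Theta> i)) (rho (\<Theta> i)) (mu (\<Theta> i)) c)
        (\<lambda>i. apply_op (lam (\<Theta> i)) (rho (\<Theta> i)) (mu (\<Theta> i)) e) x y z" for a b c e
    unfolding obs_bracket_def by (intro sum.cong) (auto simp: trunc_op_def)
  ultimately show ?thesis using assms(1)
    by (auto simp: T_3 Ob_def tree_assoc_def tdeg_def apply_op_def Let_def)
qed

theorem lemma4p10:
  fixes scale :: "'k::field \<Rightarrow> 'a::ab_group_add \<Rightarrow> 'a"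
    and L R M :: "'a \<Rightarrow> 'a \<Rightarrow> 'a"
    and N :: nat
    and \<Theta> :: "nat \<Rightarrow> 'a cochain"
  assumes "trias_algebra scale L R M"
    and "1 \<le> N"
    and "deformation scale L R M N \<Theta>"
  shows "Ob N \<Theta> \<in> cocycles scale L R M 3"
proof -
  let ?P = "trunc_op N \<Theta>"
  interpret trias_algebra scale L R M by fact
  have v: "vector_space scale" by unfold_locales
  have bl: "bilin scale (?P c i)" for c i
    using assms(3) by (intro bilin_trunc_op v) (simp add: deformation_def)
  note ba = bilin_biadditive[OF bl]
  note Ob = Ob_eq_tree_assoc[OF _ ba]
  \<comment> \<open>In degree 0 the truncated operations are the products of A, which are those in
    the coboundary.\<close>
  have P0: "?P c 0 = apply_op L R M c" for c
    using assms(3) by (simp add: trunc_op_def deformation_def)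
  have outside: "Ob N \<Theta> \<psi> as = 0" if "\<psi> \<notin> T 3 \<or> length as \<noteq> 3" for \<psi> as
    using that by (auto simp: Ob_def T_3)
  \<comment> \<open>On \<open>T 3\<close> the cochain is a \<open>tree_assoc\<close>, a sum of
    compositions of bilinear operations.\<close>
  have "multilin scale 3 (Ob N \<Theta> \<psi>)" if psi: "\<psi> \<in> T 3" for \<psi>
    unfolding multilin_def
  proof (intro allI impI)
    fix as :: "'a list" and i :: nat
    assume "length as = 3" and i: "i < 3"
    then obtain x y z where "as = [x, y, z]"
      by (auto simp: numeral_3_eq_3 length_Suc_conv)
    moreover have "i = 0 \<or> i = 1 \<or> i = 2" using i by auto
    ultimately show "Vector_Spaces.linear scale scale (\<lambda>x. Ob N \<Theta> \<psi> (as[i := x]))"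
      using linear_assoc_coeff[OF v bl bl bl bl]
      by (auto simp: Ob[OF psi] tree_assoc_def)
  qed
  then have "Ob N \<Theta> \<in> cochains scale 3"
    using outside by (auto simp: cochains_def)
  moreover have "coboundary scale L R M 3 (Ob N \<Theta>) \<psi> as = 0" for \<psi> as
  proof (cases "\<psi> \<in> T 4 \<and> length as = 4")
    case True
    then have psi: "\<psi> \<in> T 4" by simp
    obtain x y z w where as: "as = [x, y, z, w]"
      using True by (auto simp: numeral_eq_Suc length_Suc_conv)
    have d: "del_leaf 0 \<psi> \<in> T 3" "del_leaf (Suc 0) \<psi> \<in> T 3" "del_leaf 2 \<psi> \<in> T 3"
      "del_leaf 3 \<psi> \<in> T 3" "del_leaf 4 \<psi> \<in> T 3"
      using circ_T_4[rule_format, OF psi] by auto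
    have five: "{0..4::nat} = {0, 1, 2, 3, 4}" by auto
    have "coboundary scale L R M 3 (Ob N \<Theta>) \<psi> as =
        ?P (circ 0 \<psi>) 0 x (tree_assoc ?P (del_leaf 0 \<psi>) (N + 1) y z w)
      - tree_assoc ?P (del_leaf 1 \<psi>) (N + 1) (?P (circ 1 \<psi>) 0 x y) z w
      + tree_assoc ?P (del_leaf 2 \<psi>) (N + 1) x (?P (circ 2 \<psi>) 0 y z) w
      - tree_assoc ?P (del_leaf 3 \<psi>) (N + 1) x y (?P (circ 3 \<psi>) 0 z w)
      + ?P (circ 4 \<psi>) 0 (tree_assoc ?P (del_leaf 4 \<psi>) (N + 1) x y z) w"
      using psi by (simp add: coboundary_def as five coface_def P0 Ob d)
    also have "\<dots> = 0"
      \<comment> \<open>Applied at \<open>m = N + 1\<close>: the deformation property makes all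
        lower associators vanish.\<close>
      using deformation_tree_assoc[OF v assms(3)] psi
      by (intro tree_assoc_cocycle ba) auto
    finally show ?thesis .
  next
    case False
    then show ?thesis by (auto simp: coboundary_def)
  qed
  ultimately show ?thesis by (auto simp: cocycles_def)
qed

end
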